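(* Let $M$ be a $6$-manifold with an $SU(3)$-structure $(I,\langle\cdot,\cdot\rangle,\Psi=\psi_++i\psi_-)$, and let $r: T^*M\otimes \mathfrak u(3)^\perp\to\otimes^2T^*M$ be defined by $r(\alpha)(x,y)=\tfrac12\langle x\lrcorner\alpha,\,y\lrcorner\psi_+\rangle$. Then: (i) $r$ is an $SU(3)$-isomorphism; (ii) $r(\mathcal W_1^+)=\mathbb R\langle\cdot,\cdot\rangle$ and $r(\mathcal W_1^-)=\mathbb R\,\omega$; (iii) $r(\mathcal W_2^+)=\{b\in\otimes^2T^*M \mid b \text{ is trace-free symmetric and } Ib=b\}$; (iv) $r(\mathcal W_2^-)=\{b\in\otimes^2T^*M\mid b\text{ is skew-symmetric},\ Ib=b\text{ and }\langle\omega,b\rangle=0\}$; (v) $r(\mathcal W_3)=\{b\in\otimes^2T^*M\mid b\text{ is symmetric and }Ib=-b\}$; (vi) $r(\mathcal W_4)=\{b\in\otimes^2T^*M\mid b\text{ is skew-symmetric and }Ib=-b\}$.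
   Context: An $SU(3)$-structure on a $6$-manifold $M$ consists of a Riemannian metric $\langle\cdot,\cdot\rangle$, an orthogonal almost complex structure $I$ and a complex three-form $\Psi=\psi_++i\psi_-$ such that locally there is an orthonormal frame $e_1,e_2,e_3,Ie_1,Ie_2,Ie_3$ with $\Psi=(e_1+iIe_1)\wedge(e_2+iIe_2)\wedge(e_3+iIe_3)$ (vectors are identified with one-forms via the metric, $x\mapsto\langle\cdot,x\rangle$). The Kähler form is $\omega(x,y)=\langle x,Iy\rangle$. For a $(0,2)$-tensor $b$, $(Ib)(x,y)=b(Ix,Iy)$. The inner product of $p$-forms is $\langle a,b\rangle=\frac1{p!}\sum a(e_{i_1},\dots,e_{i_p})b(e_{i_1},\dots,e_{i_p})$; $\lrcorner$ is the interior product. All spaces are taken pointwise. $\mathfrak u(3)^\perp\subset\Lambda^2T^*M$ is the space of two-forms $b$ with $b(Ix,Iy)=-b(x,y)$, so $T^*M\otimes\mathfrak u(3)^\perp=\{\alpha \mid \alpha(x,y,z)=-\alpha(x,z,y)=-\alpha(x,Iy,Iz)\}$. By Gray–Hervella, $T^*M\otimes\mathfrak u(3)^\perp=\mathcal W_1\oplus\mathcal W_2\oplus\mathcal W_3\oplus\mathcal W_4$ ($U(3)$-irreducible), where $\mathcal W_1$ is the set of totally skew $\alpha$; $\mathcal W_2$ the set of $\alpha$ whose cyclic sum over $x,y,z$ vanishes; $\mathcal W_3$ the set of $\alpha$ with $\alpha(Ix,Iy,z)=\alpha(x,y,z)$ and $\sum_i\alpha(e_i,e_i,z)=0$; $\mathcal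 W_4$ the set of $\alpha$ of the form $\alpha(x,y,z)=\langle x,y\rangle\tau(z)-\langle x,z\rangle\tau(y)-\langle x,Iy\rangle\tau(Iz)+\langle x,Iz\rangle\tau(Iy)$ for a one-form $\tau$. For $i=1,2$, $\mathcal W_i=\mathcal W_i^+\oplus\mathcal W_i^-$, where $\mathcal W_i^+$ (resp. $\mathcal W_i^-$) consists of the $\alpha\in\mathcal W_i$ for which the bilinear form $r(\alpha)$ is symmetric (resp. skew-symmetric). *)

theory Defs
  imports "HOL-Analysis.Analysis"
begin

text \<open>
  All notions are pointwise: the type \<open>'a\<close> plays the role of the tangent space \<open>T\<^sub>pM\<close> at a point,
  its inner product is the Riemannian metric at that point, and \<open>k\<close>-tensors are curried
  \<open>k\<close>-linear functions, so that the interior product of \<open>x\<close> with \<open>\<alpha>\<close> is the partial application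
  \<open>\<alpha> x\<close>.  Traces and inner products are taken over the orthonormal basis \<^const>\<open>Basis\<close>.
\<close>

type_synonym 'a tensor2 = "'a \<Rightarrow> 'a \<Rightarrow> real"
type_synonym 'a tensor3 = "'a \<Rightarrow> 'a \<Rightarrow> 'a \<Rightarrow> real"
type_synonym 'a ctensor3 = "'a \<Rightarrow> 'a \<Rightarrow> 'a \<Rightarrow> complex"

definition tensors2 :: "('a::euclidean_space) tensor2 set" where
  "tensors2 = {b. bilinear b}"

definition trilinear :: "('a::euclidean_space) tensor3 \<Rightarrow> bool" where
  "trilinear \<alpha> \<longleftrightarrow>
     (\<forall>y z. linear (\<lambda>x. \<alpha> x y z)) \<and> (\<forall>x z. linear (\<lambda>y. \<alpha> x y z)) \<and> (\<forall>x y. linear (\<lambda>z. \<alpha> x y z))"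

definition symmetric_form :: "'a tensor2 \<Rightarrow> bool" where
  "symmetric_form b \<longleftrightarrow> (\<forall>x y. b x y = b y x)"

definition skew_form :: "'a tensor2 \<Rightarrow> bool" where
  "skew_form b \<longleftrightarrow> (\<forall>x y. b x y = - b y x)"

definition trace_form :: "('a::euclidean_space) tensor2 \<Rightarrow> real" where
  "trace_form b = (\<Sum>e\<in>Basis. b e e)"

definition inner_2form :: "('a::euclidean_space) tensor2 \<Rightarrow> 'a tensor2 \<Rightarrow> real" where
  "inner_2form a b = (1 / fact 2) * (\<Sum>e\<in>Basis. \<Sum>f\<in>Basis. a e f * b e f)"


subsection \<open>SU(3)-structures\<close>

definition orthonormal_list :: "('a::euclidean_space) list \<Rightarrow> bool" where
  "orthonormal_list es \<longleftrightarrow>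
     (\<forall>i<length es. \<forall>j<length es. es ! i \<bullet> es ! j = (if i = j then 1 else 0))"

definition orthogonal_complex_structure :: "(('a::euclidean_space) \<Rightarrow> 'a) \<Rightarrow> bool" where
  "orthogonal_complex_structure I \<longleftrightarrow> orthogonal_transformation I \<and> (\<forall>x. I (I x) = - x)"

text \<open>The one-form \<open>e + \<i> I e\<close>, vectors being identified with one-forms via the metric.\<close>

definition complex_oneform :: "(('a::euclidean_space) \<Rightarrow> 'a) \<Rightarrow> 'a \<Rightarrow> 'a \<Rightarrow> complex" where
  "complex_oneform I e x = of_real (x \<bullet> e) + \<i> * of_real (x \<bullet> I e)"

text \<open>
  The wedge product is normalised without factorials, so that \<open>e\<^sub>1 \<and> e\<^sub>2 \<and> e\<^sub>3\<close> takes the value \<open>1\<close>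
  on \<open>(e\<^sub>1, e\<^sub>2, e\<^sub>3)\<close>; this is the normalisation for which wedge products of distinct elements of
  an orthonormal coframe have norm \<open>1\<close>.
\<close>

definition wedge3 :: "('a \<Rightarrow> complex) \<Rightarrow> ('a \<Rightarrow> complex) \<Rightarrow> ('a \<Rightarrow> complex) \<Rightarrow> 'a ctensor3" where
  "wedge3 a b c x y z =
     det (vector [vector [a x, a y, a z],
                  vector [b x, b y, b z],
                  vector [c x, c y, c z]] :: complex ^ 3 ^ 3)"

definition su3_structure :: "(('a::euclidean_space) \<Rightarrow> 'a) \<Rightarrow> 'a ctensor3 \<Rightarrow> bool" where
  "su3_structure I \<Psi> \<longleftrightarrow>
     orthogonal_complex_structure I \<and>
     (\<exists>e1 e2 e3. orthonormal_list [e1, e2, e3, I e1, I e2, I e3] \<and>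
        \<Psi> = wedge3 (complex_oneform I e1) (complex_oneform I e2) (complex_oneform I e3))"

definition kaehler_form :: "(('a::euclidean_space) \<Rightarrow> 'a) \<Rightarrow> 'a tensor2" where
  "kaehler_form I x y = x \<bullet> I y"

text \<open>The action of \<open>I\<close> on (0,2)-tensors.\<close>

definition act_I :: "('a \<Rightarrow> 'a) \<Rightarrow> 'a tensor2 \<Rightarrow> 'a tensor2" where
  "act_I I b = (\<lambda>x y. b (I x) (I y))"


subsection \<open>The group SU(3) and its action on tensors\<close>

text \<open>SU(3) is the structure group: the linear automorphisms preserving the metric, \<open>I\<close> and \<open>\<Psi>\<close>.\<close>

definition SU3 :: "(('a::euclidean_space) \<Rightarrow> 'a) \<Rightarrow> 'a ctensor3 \<Rightarrow> ('a \<Rightarrow> 'a) set" where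
  "SU3 I \<Psi> = {A. orthogonal_transformation A \<and> (\<forall>x. A (I x) = I (A x)) \<and>
                (\<forall>x y z. \<Psi> (A x) (A y) (A z) = \<Psi> x y z)}"

definition act2 :: "('a \<Rightarrow> 'a) \<Rightarrow> 'a tensor2 \<Rightarrow> 'a tensor2" where
  "act2 A b = (\<lambda>x y. b (inv A x) (inv A y))"

definition act3 :: "('a \<Rightarrow> 'a) \<Rightarrow> 'a tensor3 \<Rightarrow> 'a tensor3" where
  "act3 A \<alpha> = (\<lambda>x y z. \<alpha> (inv A x) (inv A y) (inv A z))"

definition SU3_isomorphism ::
  "(('a::euclidean_space) \<Rightarrow> 'a) \<Rightarrow> 'a ctensor3 \<Rightarrow> 'a tensor3 set \<Rightarrow> 'a tensor2 set \<Rightarrow>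
     ('a tensor3 \<Rightarrow> 'a tensor2) \<Rightarrow> bool" where
  "SU3_isomorphism I \<Psi> D E F \<longleftrightarrow>
     (\<forall>\<alpha>\<in>D. \<forall>\<beta>\<in>D. F (\<lambda>x y z. \<alpha> x y z + \<beta> x y z) = (\<lambda>x y. F \<alpha> x y + F \<beta> x y)) \<and>
     (\<forall>c. \<forall>\<alpha>\<in>D. F (\<lambda>x y z. c * \<alpha> x y z) = (\<lambda>x y. c * F \<alpha> x y)) \<and>
     bij_betw F D E \<and>
     (\<forall>A\<in>SU3 I \<Psi>. \<forall>\<alpha>\<in>D. act3 A \<alpha> \<in> D \<and> F (act3 A \<alpha>) = act2 A (F \<alpha>))"


subsection \<open>The space \<open>T\<^sup>* \<otimes> u(3)\<^sup>\<bottom>\<close> and its Gray--Hervella components\<close>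

definition T_u3perp :: "(('a::euclidean_space) \<Rightarrow> 'a) \<Rightarrow> 'a tensor3 set" where
  "T_u3perp I = {\<alpha>. trilinear \<alpha> \<and>
     (\<forall>x y z. \<alpha> x y z = - \<alpha> x z y \<and> \<alpha> x y z = - \<alpha> x (I y) (I z))}"

definition r_map :: "('a::euclidean_space) tensor3 \<Rightarrow> 'a tensor3 \<Rightarrow> 'a tensor2" where
  "r_map \<psi>p \<alpha> = (\<lambda>x y. (1/2) * inner_2form (\<alpha> x) (\<psi>p y))"

text \<open>Skewness in the last two arguments is part of membership in \<^const>\<open>T_u3perp\<close>, so skewness in
  the first two makes \<open>\<alpha>\<close> totally skew.\<close>

definition W1 :: "(('a::euclidean_space) \<Rightarrow> 'a) \<Rightarrow> 'a tensor3 set" where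
  "W1 I = {\<alpha> \<in> T_u3perp I. \<forall>x y z. \<alpha> x y z = - \<alpha> y x z}"

definition W2 :: "(('a::euclidean_space) \<Rightarrow> 'a) \<Rightarrow> 'a tensor3 set" where
  "W2 I = {\<alpha> \<in> T_u3perp I. \<forall>x y z. \<alpha> x y z + \<alpha> y z x + \<alpha> z x y = 0}"

definition W3 :: "(('a::euclidean_space) \<Rightarrow> 'a) \<Rightarrow> 'a tensor3 set" where
  "W3 I = {\<alpha> \<in> T_u3perp I. (\<forall>x y z. \<alpha> (I x) (I y) z = \<alpha> x y z) \<and>
                          (\<forall>z. (\<Sum>e\<in>Basis. \<alpha> e e z) = 0)}"

definition W4 :: "(('a::euclidean_space) \<Rightarrow> 'a) \<Rightarrow> 'a tensor3 set" where
  "W4 I = {\<alpha> \<in> T_u3perp I. \<exists>\<tau>::'a \<Rightarrow> real. linear \<tau> \<and>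
     (\<forall>x y z. \<alpha> x y z = (x \<bullet> y) * \<tau> z - (x \<bullet> z) * \<tau> y
                        - (x \<bullet> I y) * \<tau> (I z) + (x \<bullet> I z) * \<tau> (I y))}"

definition W1_plus :: "(('a::euclidean_space) \<Rightarrow> 'a) \<Rightarrow> 'a tensor3 \<Rightarrow> 'a tensor3 set" where
  "W1_plus I \<psi>p = {\<alpha> \<in> W1 I. symmetric_form (r_map \<psi>p \<alpha>)}"

definition W1_minus :: "(('a::euclidean_space) \<Rightarrow> 'a) \<Rightarrow> 'a tensor3 \<Rightarrow> 'a tensor3 set" where
  "W1_minus I \<psi>p = {\<alpha> \<in> W1 I. skew_form (r_map \<psi>p \<alpha>)}"

definition W2_plus :: "(('a::euclidean_space) \<Rightarrow> 'a) \<Rightarrow> 'a tensor3 \<Rightarrow> 'a tensor3 set" where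
  "W2_plus I \<psi>p = {\<alpha> \<in> W2 I. symmetric_form (r_map \<psi>p \<alpha>)}"

definition W2_minus :: "(('a::euclidean_space) \<Rightarrow> 'a) \<Rightarrow> 'a tensor3 \<Rightarrow> 'a tensor3 set" where
  "W2_minus I \<psi>p = {\<alpha> \<in> W2 I. skew_form (r_map \<psi>p \<alpha>)}"

end

theory Submission
  imports Defs
begin

text \<open>
  Let \<open>P\<close> be the cross product on \<open>\<complex>\<^sup>3\<close>, defined by \<open>\<langle>P x y, z\<rangle> = \<psi>\<^sub>+(x, y, z)\<close>. It is antilinear in
  both arguments, and \<open>\<langle>P v x, P y z\<rangle>\<close> is the real part of the Hermitian Lagrange identity; after a
  frame has been used to verify this, everything else is frame-free. Every two-form in
  \<open>u(3)\<^sup>\<bottom>\<close> has the form \<open>v \<lrcorner> \<psi>\<^sub>+\<close>, so \<open>r\<close> is inverted by \<open>b \<mapsto> b(x, P y z)\<close>, which is equivariant.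
  Under this correspondence \<open>W\<^sub>1\<close> and \<open>W\<^sub>2\<close> are the complex multiples of the metric and the complex
  trace-free part of the \<open>I\<close>-invariant tensors, because the cyclic sum of the tensor of such a \<open>b\<close> is
  the real part of \<open>tr\<^sub>\<complex>(b) \<Psi>\<close>, while \<open>W\<^sub>3\<close> and \<open>W\<^sub>4\<close> are the symmetric and skew parts of the \<open>I\<close>-anti-invariant ones.
\<close>

section \<open>Orthonormal frames and multilinear algebra\<close>

lemma orthonormal_list_distinct:
  assumes "orthonormal_list es"
  shows "distinct es"
  using assms unfolding orthonormal_list_def distinct_conv_nth
  by (metis one_neq_zero)

text \<open>An orthonormal list as long as the dimension spans the space, so \<open>x\<close> can be
  expanded in it. This makes inner products computable in an adapted frame, which need not be
  \<open>Basis\<close>.\<close>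

lemma orthonormal_list_parseval:
  fixes es :: "'a::euclidean_space list"
  assumes on: "orthonormal_list es" and len: "length es = DIM('a)"
  shows "x \<bullet> y = (\<Sum>u\<leftarrow>es. (x \<bullet> u) * (y \<bullet> u))"
proof -
  have dist: "distinct es" using on by (rule orthonormal_list_distinct)
  have orth: "pairwise orthogonal (set es)"
    using on unfolding pairwise_def orthogonal_def orthonormal_list_def
    by (auto simp: in_set_conv_nth)
  have unit: "u \<bullet> u = 1" if "u \<in> set es" for u
    using on that unfolding orthonormal_list_def in_set_conv_nth by auto
  have nrm: "norm u = 1" if "u \<in> set es" for u
    using unit[OF that] by (simp add: norm_eq_1)
  have "0 \<notin> set es" using unit by force
  then have "independent (set es)" using orth pairwise_orthogonal_independent by blast
  moreover have "card (set es) = DIM('a)" using dist len distinct_card by metis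
  ultimately have "span (set es) = UNIV"
    by (metis card_eq_dim dim_UNIV finite_set order_refl span_superset subset_UNIV top.extremum_uniqueI span_eq_dim dim_span)
  then have "(\<Sum>u\<in>set es. (x \<bullet> u) *\<^sub>R u) = x"
    using orthonormal_basis_expand[OF orth] nrm by simp
  then have "x \<bullet> y = (\<Sum>u\<in>set es. (x \<bullet> u) *\<^sub>R u) \<bullet> y" by simp
  also have "\<dots> = (\<Sum>u\<in>set es. (x \<bullet> u) * (y \<bullet> u))"
    unfolding inner_sum_left inner_scaleR_left by (simp add: inner_commute)
  also have "\<dots> = (\<Sum>u\<leftarrow>es. (x \<bullet> u) * (y \<bullet> u))"
    using dist by (simp add: sum_list_distinct_conv_sum_set)
  finally show ?thesis .
qed

lemma orthogonal_complex_structureD: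
  assumes "orthogonal_complex_structure I"
  shows "linear I" "I (I x) = - x" "I x \<bullet> I y = x \<bullet> y" "I x \<bullet> y = - (x \<bullet> I y)"
    and "x \<bullet> I x = 0"
proof -
  show lin: "linear I" and sq: "I (I x) = - x" and iso: "I x \<bullet> I y = x \<bullet> y" for x y
    using assms unfolding orthogonal_complex_structure_def orthogonal_transformation_def by auto
  show skew: "I x \<bullet> y = - (x \<bullet> I y)" for x y
    using iso[of x "I y"] sq[of y] by simp
  show "x \<bullet> I x = 0" using skew[of x x] by (simp add: inner_commute)
qed

lemma linear_functional_sum_Basis:
  fixes h :: "'a::euclidean_space \<Rightarrow> real"
  assumes "linear h"
  shows "(\<Sum>e\<in>Basis. (x \<bullet> e) * h e) = h x"
proof -
  have "(\<Sum>e\<in>Basis. (x \<bullet> e) * h e) = h (\<Sum>e\<in>Basis. (x \<bullet> e) *\<^sub>R e)"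
    by (simp add: linear_sum[OF assms] linear_cmul[OF assms])
  then show ?thesis by (simp add: euclidean_representation)
qed

lemma linear_functional_representation:
  fixes h :: "'a::euclidean_space \<Rightarrow> real"
  assumes "linear h"
  shows "\<exists>v. \<forall>x. h x = v \<bullet> x"
proof (intro exI allI)
  fix x
  show "h x = (\<Sum>e\<in>Basis. h e *\<^sub>R e) \<bullet> x"
    using linear_functional_sum_Basis[OF assms, of x]
    by (simp add: inner_sum_left inner_commute[of x] mult.commute)
qed

lemma bilinear_linear:
  assumes "bilinear b"
  shows "linear (b x)" and "linear (\<lambda>x. b x y)"
  using assms unfolding bilinear_def by auto

lemma bilinear_scale:
  fixes b :: "'a::euclidean_space \<Rightarrow> 'a \<Rightarrow> real"
  assumes "bilinear b"
  shows "bilinear (\<lambda>x y. c * b x y)"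
proof -
  have "linear (\<lambda>y. c *\<^sub>R b x y)" "linear (\<lambda>y. c *\<^sub>R b y x)" for x
    using assms by (auto simp only: bilinear_def intro!: linear_compose_scale_right)
  then show ?thesis by (simp add: bilinear_def)
qed

text \<open>Expanding \<open>L e\<close> in \<open>Basis\<close> and swapping the two sums
  transposes the matrix of \<open>L\<close>, which is skew. It is applied to the skew operators
  \<open>P w\<close> and \<open>\<lambda>x. P x z\<close>.\<close>

lemma sum_Basis_skew_adjoint:
  fixes b :: "'a::euclidean_space \<Rightarrow> 'a \<Rightarrow> real"
  assumes b: "bilinear b" and skew: "\<And>x y. L x \<bullet> y = - (L y \<bullet> x)"
  shows "(\<Sum>e\<in>Basis. b (L e) e) = - (\<Sum>e\<in>Basis. b e (L e))"
proof -
  have "(\<Sum>e\<in>Basis. b (L e) e) = (\<Sum>e\<in>Basis. \<Sum>f\<in>Basis. (L e \<bullet> f) * b f e)"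
    by (simp add: linear_functional_sum_Basis[OF bilinear_linear(2)[OF b]])
  also have "\<dots> = (\<Sum>e\<in>Basis. \<Sum>f\<in>Basis. (L f \<bullet> e) * b e f)"
    by (rule sum.swap)
  also have "\<dots> = - (\<Sum>e\<in>Basis. \<Sum>f\<in>Basis. (L e \<bullet> f) * b e f)"
    unfolding sum_negf[symmetric]
  proof (intro sum.cong refl)
    fix e f show "(L f \<bullet> e) * b e f = - ((L e \<bullet> f) * b e f)"
      using skew[of e f] by simp
  qed
  also have "\<dots> = - (\<Sum>e\<in>Basis. b e (L e))"
    by (simp add: linear_functional_sum_Basis[OF bilinear_linear(1)[OF b]])
  finally show ?thesis .
qed

lemma bilinear_compose:
  assumes "bilinear b" "linear f" "linear g"
  shows "bilinear (\<lambda>x y. b (f x) (g y))"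
  using linear_compose[OF assms(3) bilinear_linear(1)[OF assms(1)]]
    linear_compose[OF assms(2) bilinear_linear(2)[OF assms(1)]]
  by (simp add: bilinear_def o_def)

lemma bilinear_add:
  assumes "bilinear b" "bilinear c"
  shows "bilinear (\<lambda>x y. b x y + c x y)"
  using assms by (auto simp only: bilinear_def intro!: linear_compose_add)

lemma bilinear_inner: "bilinear (\<lambda>x y::'a::euclidean_space. x \<bullet> y)"
  by (simp add: bilinear_conv_bounded_bilinear bounded_bilinear_inner)

lemma trilinear_add:
  assumes "trilinear \<alpha>" "trilinear \<beta>"
  shows "trilinear (\<lambda>x y z. \<alpha> x y z + \<beta> x y z)"
  using assms by (auto simp only: trilinear_def intro!: linear_compose_add)

lemma trilinear_rotate:
  assumes "trilinear \<alpha>"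
  shows "trilinear (\<lambda>x y z. \<alpha> y z x)"
  using assms by (simp add: trilinear_def)

section \<open>The cross product of an SU(3)-structure\<close>

locale su3_cross =
  fixes I :: "'a::euclidean_space \<Rightarrow> 'a" and P :: "'a \<Rightarrow> 'a \<Rightarrow> 'a"
  assumes ocs: "orthogonal_complex_structure I"
    and dim: "DIM('a) = 6"
    and bilinear_P: "bilinear P"
    and P_skew: "P y x = - P x y"
    and P_cyclic: "P x y \<bullet> z = P y z \<bullet> x"
    and P_I_left: "P (I x) y = - I (P x y)"
    and P_inner_P: "P v x \<bullet> P y z = (v \<bullet> y) * (x \<bullet> z) - (v \<bullet> z) * (x \<bullet> y)
                      - (v \<bullet> I y) * (x \<bullet> I z) + (v \<bullet> I z) * (x \<bullet> I y)"

text \<open>In the complex coordinates given by the frame, \<open>\<Psi>\<close> is the determinant.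
  Expanding it along the column of \<open>z\<close> produces the cofactors \<open>w1\<close>,
  \<open>w2\<close>, \<open>w3\<close>, and the real part of the result is an inner product with
  \<open>z\<close>.\<close>

lemma su3_structure_imp_su3_cross:
  fixes I :: "'a::euclidean_space \<Rightarrow> 'a"
  assumes dim: "DIM('a) = 6"
    and Psi: "\<Psi> = (\<lambda>x y z. of_real (\<psi>p x y z) + \<i> * of_real (\<psi>m x y z))"
    and su3: "su3_structure I \<Psi>"
  obtains P where "su3_cross I P" "\<And>x y z. \<psi>p x y z = P x y \<bullet> z"
proof -
  obtain e1 e2 e3 where ocs: "orthogonal_complex_structure I"
    and on: "orthonormal_list [e1, e2, e3, I e1, I e2, I e3]"
    and wedge: "\<Psi> = wedge3 (complex_oneform I e1) (complex_oneform I e2) (complex_oneform I e3)"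
    using su3 unfolding su3_structure_def by auto
  note ocsD = orthogonal_complex_structureD[OF ocs]
  have I_simps: "I x \<bullet> y = - (x \<bullet> I y)" "I (I x) = - x" for x y by (fact ocsD)+
  define \<zeta>1 \<zeta>2 \<zeta>3 where "\<zeta>1 = complex_oneform I e1"
    and "\<zeta>2 = complex_oneform I e2" and "\<zeta>3 = complex_oneform I e3"
  note \<zeta>_defs = \<zeta>1_def \<zeta>2_def \<zeta>3_def complex_oneform_def
  have re_im: "Re (complex_oneform I e x) = x \<bullet> e" "Im (complex_oneform I e x) = x \<bullet> I e" for e x
    by (simp_all add: complex_oneform_def)
  define w1 w2 w3 where "w1 = (\<lambda>x y. \<zeta>2 x * \<zeta>3 y - \<zeta>3 x * \<zeta>2 y)"
    and "w2 = (\<lambda>x y. \<zeta>3 x * \<zeta>1 y - \<zeta>1 x * \<zeta>3 y)"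
    and "w3 = (\<lambda>x y. \<zeta>1 x * \<zeta>2 y - \<zeta>2 x * \<zeta>1 y)"
  note w_defs = w1_def w2_def w3_def
  \<comment> \<open>the complex conjugate of the cross product \<open>\<zeta> x \<times> \<zeta> y\<close>\<close>
  define P where "P = (\<lambda>x y. Re (w1 x y) *\<^sub>R e1 + Re (w2 x y) *\<^sub>R e2 + Re (w3 x y) *\<^sub>R e3
    - Im (w1 x y) *\<^sub>R I e1 - Im (w2 x y) *\<^sub>R I e2 - Im (w3 x y) *\<^sub>R I e3)"
  have psi: "\<psi>p x y z = P x y \<bullet> z" for x y z
  proof -
    have "complex_of_real (\<psi>p x y z) + \<i> * of_real (\<psi>m x y z) = wedge3 \<zeta>1 \<zeta>2 \<zeta>3 x y z"
      using Psi wedge unfolding \<zeta>1_def \<zeta>2_def \<zeta>3_def by metis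
    from arg_cong[OF this, of Re] show ?thesis
      unfolding wedge3_def det_3 P_def w_defs \<zeta>1_def \<zeta>2_def \<zeta>3_def
      by (simp add: re_im inner_diff_left inner_add_left inner_commute algebra_simps)
  qed
  \<comment> \<open>The frame has six members, so the dimension hypothesis makes it a basis.\<close>
  have parseval: "x \<bullet> y = (x \<bullet> e1) * (y \<bullet> e1) + (x \<bullet> e2) * (y \<bullet> e2) + (x \<bullet> e3) * (y \<bullet> e3)
      + (x \<bullet> I e1) * (y \<bullet> I e1) + (x \<bullet> I e2) * (y \<bullet> I e2) + (x \<bullet> I e3) * (y \<bullet> I e3)" for x y
    using orthonormal_list_parseval[OF on, of x y] dim by simp
  have "su3_cross I P"
  proof
    show "orthogonal_complex_structure I" "DIM('a) = 6" by fact+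
    show "bilinear P"
      unfolding bilinear_def P_def w_defs \<zeta>1_def \<zeta>2_def \<zeta>3_def
      by (auto intro!: linearI simp: re_im inner_add_left algebra_simps)
    show "P y x = - P x y" for x y
      unfolding P_def w_defs by (simp add: algebra_simps)
    show "P x y \<bullet> z = P y z \<bullet> x" for x y z
      unfolding P_def w_defs \<zeta>1_def \<zeta>2_def \<zeta>3_def
      by (simp add: re_im inner_diff_left inner_add_left inner_commute algebra_simps)
    \<comment> \<open>The coordinates are complex linear for \<open>I\<close>; the conjugation in
      \<open>P\<close> then turns linearity of the cofactors into antilinearity.\<close>
    have \<zeta>_I: "\<zeta>1 (I x) = \<i> * \<zeta>1 x" "\<zeta>2 (I x) = \<i> * \<zeta>2 x" "\<zeta>3 (I x) = \<i> * \<zeta>3 x" for x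
      by (simp_all add: \<zeta>_defs I_simps ocsD(3) complex_eq_iff)
    show "P (I x) y = - I (P x y)" for x y
      unfolding P_def w_defs \<zeta>_I
      by (simp add: linear_add[OF ocsD(1)] linear_diff[OF ocsD(1)] linear_cmul[OF ocsD(1)] I_simps)
        (simp add: algebra_simps)
    fix v x y z
    have comps: "P x y \<bullet> e1 = Re (w1 x y)" "P x y \<bullet> e2 = Re (w2 x y)" "P x y \<bullet> e3 = Re (w3 x y)"
      "P x y \<bullet> I e1 = - Im (w1 x y)" "P x y \<bullet> I e2 = - Im (w2 x y)" "P x y \<bullet> I e3 = - Im (w3 x y)"
      for x y
    proof -
      have frame: "\<forall>i<6. \<forall>j<6. [e1, e2, e3, I e1, I e2, I e3] ! i \<bullet> [e1, e2, e3, I e1, I e2, I e3] ! j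
          = (if i = j then 1 else 0)"
        using on unfolding orthonormal_list_def by simp
      show "P x y \<bullet> e1 = Re (w1 x y)" "P x y \<bullet> e2 = Re (w2 x y)" "P x y \<bullet> e3 = Re (w3 x y)"
        "P x y \<bullet> I e1 = - Im (w1 x y)" "P x y \<bullet> I e2 = - Im (w2 x y)" "P x y \<bullet> I e3 = - Im (w3 x y)"
        using frame unfolding P_def
        by (simp_all add: All_less_Suc numeral_eq_Suc inner_diff_left inner_add_left)
    qed
    \<comment> \<open>With h(a,b) = \<open>a \<bullet> b + \<i> * (a \<bullet> I b)\<close>, the
      right-hand side is the real part of h(v,y) h(x,z) - h(v,z) h(x,y). In frame coordinates both
      sides are polynomials that agree after expansion.\<close>
    show "P v x \<bullet> P y z = (v \<bullet> y) * (x \<bullet> z) - (v \<bullet> z) * (x \<bullet> y)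
        - (v \<bullet> I y) * (x \<bullet> I z) + (v \<bullet> I z) * (x \<bullet> I y)"
      unfolding parseval[of "P v x" "P y z"] parseval[of v y] parseval[of v z] parseval[of x y]
        parseval[of x z] parseval[of v "I y"] parseval[of v "I z"] parseval[of x "I y"]
        parseval[of x "I z"] comps
      unfolding w_defs \<zeta>1_def \<zeta>2_def \<zeta>3_def
      by (simp add: re_im I_simps ocsD(3) algebra_simps)
  qed
  with psi show thesis using that by blast
qed

section \<open>Contraction identities for the cross product\<close>

context su3_cross
begin

lemmas I_linear = orthogonal_complex_structureD(1)[OF ocs]
lemmas I_I [simp] = orthogonal_complex_structureD(2)[OF ocs]
lemmas I_isometry [simp] = orthogonal_complex_structureD(3)[OF ocs]
lemmas I_inner = orthogonal_complex_structureD(4)[OF ocs]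
lemmas I_orthogonal [simp] = orthogonal_complex_structureD(5)[OF ocs]

lemma I_minus [simp]: "I (- x) = - I x"
  by (rule linear_neg[OF I_linear])

lemma P_I_right: "P x (I y) = - I (P x y)"
  using P_skew[of x "I y"] P_I_left[of y x] P_skew[of x y] by simp

lemma P_inner_right: "P x y \<bullet> z = - (P x z \<bullet> y)"
  using P_cyclic[of x y z] P_cyclic[of x z y] P_skew[of z y] by simp

lemma P_inner_left: "P x y \<bullet> z = - (P z y \<bullet> x)"
  using P_cyclic[of x y z] P_skew[of z y] by simp

text \<open>The counterpart of the expansion of a double vector product: cyclicity rewrites the
  inner product with \<open>y\<close> as \<open>P w e \<bullet> P x y\<close>, which
  \<open>P_inner_P\<close> evaluates.\<close>

lemma P_P: "P (P w e) x = (w \<bullet> x) *\<^sub>R e - (x \<bullet> e) *\<^sub>R w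
    + (w \<bullet> I x) *\<^sub>R I e + (x \<bullet> I e) *\<^sub>R I w"
proof (rule vector_eq_rdot[THEN iffD1], rule allI)
  fix y
  have "P (P w e) x \<bullet> y = P w e \<bullet> P x y"
    by (metis P_cyclic inner_commute)
  also have "\<dots> = ((w \<bullet> x) *\<^sub>R e - (x \<bullet> e) *\<^sub>R w
    + (w \<bullet> I x) *\<^sub>R I e + (x \<bullet> I e) *\<^sub>R I w) \<bullet> y"
    unfolding P_inner_P using I_inner[of e y] I_inner[of e x] I_inner[of w y]
    by (simp add: inner_add_left inner_diff_left inner_commute algebra_simps)
  finally show "P (P w e) x \<bullet> y = \<dots>" .
qed

lemma sum_Basis_I:
  fixes h :: "'a \<Rightarrow> real"
  assumes "linear h"
  shows "(\<Sum>e\<in>Basis. (x \<bullet> I e) * h e) = - h (I x)"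
proof -
  have "(\<Sum>e\<in>Basis. (x \<bullet> I e) * h e) = (\<Sum>e\<in>Basis. - ((I x \<bullet> e) * h e))"
    by (simp add: I_inner)
  then show ?thesis unfolding sum_negf linear_functional_sum_Basis[OF assms] .
qed

text \<open>Summing \<open>P_P\<close> with \<open>x = e\<close> gives w - 6w + w, the 6 being the
  dimension; the last term of \<open>P_P\<close> drops out because \<open>e\<close> is orthogonal to
  \<open>I e\<close>. The resulting 4 matches the factor 1/4 in \<open>r_map_eq\<close>, so that
  \<open>tens\<close> inverts \<open>r_map psi\<close> without a constant.\<close>

lemma sum_P_P: "(\<Sum>e\<in>Basis. P (P w e) e) = - (4 *\<^sub>R w)"
proof (rule vector_eq_rdot[THEN iffD1], rule allI)
  fix y
  have lin: "linear (\<lambda>e::'a. e \<bullet> y)" by (rule bounded_linear_inner_left[THEN bounded_linear.linear])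
  have linI: "linear (\<lambda>e. I e \<bullet> y)" using linear_compose[OF I_linear lin] by (simp add: o_def)
  have "(\<Sum>e\<in>Basis. P (P w e) e) \<bullet> y
    = (\<Sum>e\<in>Basis. (w \<bullet> e) * (e \<bullet> y) - w \<bullet> y + (w \<bullet> I e) * (I e \<bullet> y))"
    unfolding P_P inner_sum_left
    by (intro sum.cong refl) (simp add: inner_add_left inner_diff_left)
  also have "\<dots> = w \<bullet> y - 6 * (w \<bullet> y) - I (I w) \<bullet> y"
    unfolding sum.distrib sum_subtractf linear_functional_sum_Basis[OF lin] sum_Basis_I[OF linI]
    using dim by simp
  finally show "(\<Sum>e\<in>Basis. P (P w e) e) \<bullet> y = - (4 *\<^sub>R w) \<bullet> y" by simp
qed

section \<open>The inverse of r\<close>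

definition psi :: "'a tensor3" where
  "psi x y z = P x y \<bullet> z"

definition tens :: "'a tensor2 \<Rightarrow> 'a tensor3" where
  "tens b x y z = b x (P y z)"

text \<open>One of the two sums in \<open>inner_2form\<close> only expands the vector
  \<open>P y e\<close> in \<open>Basis\<close>. The factor 1/4 combines the 1/2 of
  \<open>r_map\<close> with the 1/2! of the inner product.\<close>

lemma r_map_eq:
  assumes "trilinear \<alpha>"
  shows "r_map psi \<alpha> x y = (1/4) * (\<Sum>e\<in>Basis. \<alpha> x e (P y e))"
proof -
  have lin: "linear (\<alpha> x e)" for e using assms by (simp add: trilinear_def)
  have "(\<Sum>f\<in>Basis. \<alpha> x e f * psi y e f) = \<alpha> x e (P y e)" for e
    using linear_functional_sum_Basis[OF lin, of "P y e" e] by (simp add: psi_def mult.commute)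
  then show ?thesis by (simp add: r_map_def inner_2form_def)
qed

lemma tens_trilinear:
  assumes "b \<in> tensors2"
  shows "trilinear (tens b)"
proof -
  have b: "bilinear b" using assms by (simp add: tensors2_def)
  have "linear (\<lambda>y. b x (P y z))" "linear (\<lambda>z. b x (P y z))" for x y z
    using linear_compose[OF bilinear_linear(2)[OF bilinear_P] bilinear_linear(1)[OF b]]
      linear_compose[OF bilinear_linear(1)[OF bilinear_P] bilinear_linear(1)[OF b]]
    by (simp_all add: o_def)
  then show ?thesis using bilinear_linear(2)[OF b] by (simp add: trilinear_def tens_def)
qed

text \<open>Antilinearity in both arguments gives \<open>P (I y) (I z) = - P y z\<close>, which is
  the type condition.\<close>

lemma tens_in_T_u3perp:
  assumes "b \<in> tensors2"
  shows "tens b \<in> T_u3perp I"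
proof -
  have b: "bilinear b" using assms by (simp add: tensors2_def)
  have "b x (P y z) = - b x (P z y)" for x y z
    using P_skew[of z y] bilinear_rneg[OF b] by simp
  moreover have "b x (P y z) = - b x (P (I y) (I z))" for x y z
    by (simp add: P_I_left P_I_right bilinear_rneg[OF b])
  ultimately show ?thesis using tens_trilinear[OF assms] unfolding T_u3perp_def tens_def by blast
qed

lemma r_map_tens:
  assumes "b \<in> tensors2"
  shows "r_map psi (tens b) = b"
proof (intro ext)
  fix x y
  have b: "bilinear b" using assms by (simp add: tensors2_def)
  have "(\<Sum>e\<in>Basis. tens b x e (P y e)) = (\<Sum>e\<in>Basis. b x (- P (P y e) e))"
    unfolding tens_def by (metis P_skew)
  also have "\<dots> = b x (- (\<Sum>e\<in>Basis. P (P y e) e))"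
    by (simp only: linear_sum[OF bilinear_linear(1)[OF b]] sum_negf[symmetric])
  also have "\<dots> = 4 * b x y"
    by (simp add: sum_P_P bilinear_rmul[OF b])
  finally show "r_map psi (tens b) x y = b x y"
    by (simp add: r_map_eq[OF tens_trilinear[OF assms]])
qed

text \<open>Each of the four terms of \<open>P_P\<close> contributes one copy of
  \<open>\<beta> y z\<close>. Hence \<open>\<beta>\<close> can be recovered from its contraction
  with \<open>P\<close>, which yields both \<open>tens_r_map\<close> and
  \<open>skew_type_representation\<close>.\<close>

lemma u3perp_contraction:
  fixes \<beta> :: "'a tensor2"
  assumes b: "bilinear \<beta>" and skew: "\<And>x y. \<beta> x y = - \<beta> y x"
    and anti: "\<And>x y. \<beta> (I x) (I y) = - \<beta> x y"
  shows "(\<Sum>e\<in>Basis. \<beta> e (P (P y z) e)) = 4 * \<beta> y z"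
proof -
  have lin: "linear (\<lambda>e. \<beta> e z)" for z by (rule bilinear_linear(2)[OF b])
  have "\<beta> e (P (P y z) e) = (y \<bullet> e) * \<beta> e z - (z \<bullet> e) * \<beta> e y
      + (y \<bullet> I e) * \<beta> e (I z) - (z \<bullet> I e) * \<beta> e (I y)" for e
  proof -
    have "P (P y z) e = (y \<bullet> e) *\<^sub>R z - (z \<bullet> e) *\<^sub>R y + (y \<bullet> I e) *\<^sub>R I z - (z \<bullet> I e) *\<^sub>R I y"
      unfolding P_P using I_inner[of z e] by (simp add: inner_commute)
    then show ?thesis
      by (simp add: bilinear_radd[OF b] bilinear_rsub[OF b] bilinear_rmul[OF b])
  qed
  then have "(\<Sum>e\<in>Basis. \<beta> e (P (P y z) e)) = \<beta> y z - \<beta> z y - \<beta> (I y) (I z) + \<beta> (I z) (I y)"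
    by (simp add: sum.distrib sum_subtractf linear_functional_sum_Basis[OF lin] sum_Basis_I[OF lin])
  then show ?thesis using anti skew[of y z] by simp
qed

lemma r_map_in_tensors2:
  assumes "trilinear \<alpha>"
  shows "r_map psi \<alpha> \<in> tensors2"
proof -
  have "bilinear (\<lambda>x y. \<Sum>e\<in>Basis. \<alpha> x e (P y e))"
  proof -
    have 1: "linear (\<lambda>x. \<alpha> x y z)" "linear (\<alpha> x y)" for x y z
      using assms by (simp_all add: trilinear_def)
    have 2: "linear (\<lambda>y. \<alpha> x e (P y e))" for x e
      using linear_compose[OF bilinear_linear(2)[OF bilinear_P] 1(2)] by (simp add: o_def)
    show ?thesis unfolding bilinear_def
      by (auto intro!: linear_compose_sum 1 2)
  qed
  then have "bilinear (\<lambda>x y. (1/4) * (\<Sum>e\<in>Basis. \<alpha> x e (P y e)))"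
    by (rule bilinear_scale)
  then show ?thesis by (simp add: tensors2_def r_map_eq[OF assms, abs_def])
qed

lemma T_u3perp_D:
  assumes "\<alpha> \<in> T_u3perp I"
  shows "trilinear \<alpha>" "bilinear (\<alpha> x)" "\<alpha> x y z = - \<alpha> x z y" "\<alpha> x (I y) (I z) = - \<alpha> x y z"
proof -
  have "trilinear \<alpha>" and *: "\<alpha> x y z = - \<alpha> x z y \<and> \<alpha> x y z = - \<alpha> x (I y) (I z)"
    using assms unfolding T_u3perp_def by blast+
  then show "trilinear \<alpha>" "bilinear (\<alpha> x)"
    by (auto simp: trilinear_def bilinear_def)
  show "\<alpha> x y z = - \<alpha> x z y" "\<alpha> x (I y) (I z) = - \<alpha> x y z"
    using * by linarith+
qed

lemma tens_r_map:
  assumes "\<alpha> \<in> T_u3perp I"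
  shows "tens (r_map psi \<alpha>) = \<alpha>"
proof (intro ext)
  fix x y z
  note D = T_u3perp_D[OF assms]
  show "tens (r_map psi \<alpha>) x y z = \<alpha> x y z"
    using u3perp_contraction[of "\<alpha> x" y z, OF D(2) D(3) D(4)]
    by (simp add: tens_def r_map_eq[OF D(1)])
qed

text \<open>The contraction of \<open>b\<close> with \<open>P w\<close> is linear in
  \<open>w\<close>, hence an inner product with some \<open>u\<close>. Taking
  \<open>w = P x y\<close> recovers \<open>4 * b x y\<close>, so \<open>v\<close> is a quarter of
  \<open>u\<close>.\<close>

lemma skew_type_representation:
  fixes b :: "'a tensor2"
  assumes b: "bilinear b" and skew: "\<And>x y. b x y = - b y x"
    and anti: "\<And>x y. b (I x) (I y) = - b x y"
  obtains v where "\<And>x y. b x y = P v x \<bullet> y"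
proof -
  have "linear (\<lambda>w. \<Sum>e\<in>Basis. b e (P w e))"
  proof (rule linear_compose_sum, rule ballI)
    fix e show "linear (\<lambda>w. b e (P w e))"
      using linear_compose[OF bilinear_linear(2)[OF bilinear_P] bilinear_linear(1)[OF b]] by (simp add: o_def)
  qed
  then obtain u where u: "\<And>w. (\<Sum>e\<in>Basis. b e (P w e)) = u \<bullet> w"
    using linear_functional_representation by blast
  have "b x y = P ((1/4) *\<^sub>R u) x \<bullet> y" for x y
    using u3perp_contraction[OF assms, of x y] u[of "P x y"] P_cyclic[of u x y]
    by (simp add: bilinear_lmul[OF bilinear_P] inner_commute)
  then show thesis using that by blast
qed

lemma tens_inject:
  assumes "b \<in> tensors2" "c \<in> tensors2" "tens b = tens c"
  shows "b = c"
  using assms r_map_tens by metis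

lemma bij_betw_r_map: "bij_betw (r_map psi) (T_u3perp I) tensors2"
  by (rule bij_betw_byWitness[where f' = tens])
    (auto simp: tens_r_map r_map_tens tens_in_T_u3perp r_map_in_tensors2 dest: T_u3perp_D(1))

text \<open>Since \<open>tens\<close> inverts \<open>r_map psi\<close>, each image can be found by
  deciding for which \<open>b\<close> the tensor \<open>tens b\<close> satisfies the defining
  condition.\<close>

lemma image_r_map: "r_map psi ` {\<alpha> \<in> T_u3perp I. Q \<alpha>} = {b \<in> tensors2. Q (tens b)}"
proof (intro equalityI subsetI)
  fix b assume "b \<in> {b \<in> tensors2. Q (tens b)}"
  then show "b \<in> r_map psi ` {\<alpha> \<in> T_u3perp I. Q \<alpha>}"
    by (intro image_eqI[of _ _ "tens b"]) (auto simp: r_map_tens tens_in_T_u3perp)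
qed (auto simp: tens_r_map r_map_in_tensors2 dest: T_u3perp_D(1))

section \<open>Invariance under I, complex traces and scalar forms\<close>

lemma act_I_in_tensors2: "b \<in> tensors2 \<Longrightarrow> act_I I b \<in> tensors2"
  by (simp add: tensors2_def act_I_def bilinear_compose I_linear)

text \<open>The sign comes from pulling \<open>I\<close> out of the first argument of the antilinear
  \<open>P\<close>.\<close>

lemma tens_act_I:
  assumes "b \<in> tensors2"
  shows "tens (act_I I b) x y z = - tens b (I x) (I y) z"
  using assms by (simp add: tens_def act_I_def tensors2_def P_I_left bilinear_rneg)

lemma tens_I_swap: "tens b x (I y) z = tens b x y (I z)"
  by (simp add: tens_def P_I_left P_I_right)

lemma act_I_eqD: "act_I I b = b \<Longrightarrow> b (I x) (I y) = b x y"
  by (metis act_I_def)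

lemma act_I_uminusD: "act_I I b = (\<lambda>x y. - b x y) \<Longrightarrow> b (I x) (I y) = - b x y"
  by (metis act_I_def)

text \<open>For an \<open>I\<close>-invariant \<open>b\<close>, \<open>trace_form b\<close> and
  \<open>trace_I b\<close> are, up to constants, the real and imaginary parts of the complex
  trace.\<close>

definition trace_I :: "'a tensor2 \<Rightarrow> real" where
  "trace_I b = (\<Sum>e\<in>Basis. b e (I e))"

text \<open>These are the real parts of the complex multiples of the Hermitian form whose real part
  is the metric and whose imaginary part is \<open>kaehler_form I\<close>.\<close>

definition scalar_form :: "real \<Rightarrow> real \<Rightarrow> 'a tensor2" where
  "scalar_form c d x y = c * (x \<bullet> y) + d * kaehler_form I x y"

lemma scalar_form_in_tensors2: "scalar_form c d \<in> tensors2"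
proof -
  have "bilinear (\<lambda>x y. c * (x \<bullet> y) + d * (x \<bullet> I y))"
    by (intro bilinear_add bilinear_scale bilinear_inner
        bilinear_compose[OF bilinear_inner _ I_linear, where f="\<lambda>x. x", simplified] linear_id[unfolded id_def])
  then show ?thesis
    by (simp add: tensors2_def scalar_form_def[abs_def] kaehler_form_def)
qed

lemma scalar_form_eq_0_iff: "scalar_form c d = (\<lambda>x y. 0) \<longleftrightarrow> c = 0 \<and> d = 0"
proof
  assume *: "scalar_form c d = (\<lambda>x y. 0)"
  obtain e :: 'a where e: "e \<in> Basis" using SOME_Basis by blast
  have "scalar_form c d e e = 0" "scalar_form c d e (I e) = 0" using * by simp_all
  then show "c = 0 \<and> d = 0" using e by (simp add: scalar_form_def kaehler_form_def)
qed (simp add: scalar_form_def fun_eq_iff)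

text \<open>In the expansion by \<open>P_P\<close>, invariance merges \<open>b x w\<close> and
  \<open>b (I x) (I w)\<close> into \<open>2 * b x w\<close>.\<close>

lemma sum_bilinear_P_P:
  fixes b :: "'a tensor2"
  assumes b: "bilinear b" and inv: "\<And>x y. b (I x) (I y) = b x y"
  shows "(\<Sum>e\<in>Basis. b e (P (P w e) x)) = (x \<bullet> w) * trace_form b - (x \<bullet> I w) * trace_I b - 2 * b x w"
proof -
  note lin = bilinear_linear(2)[OF b]
  have "b e (P (P w e) x) = (w \<bullet> x) * b e e - (x \<bullet> e) * b e w
      + (w \<bullet> I x) * b e (I e) + (x \<bullet> I e) * b e (I w)" for e
    unfolding P_P by (simp add: bilinear_radd[OF b] bilinear_rsub[OF b] bilinear_rmul[OF b])
  then have "(\<Sum>e\<in>Basis. b e (P (P w e) x)) = (w \<bullet> x) * trace_form b - b x w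
      + (w \<bullet> I x) * trace_I b - b (I x) (I w)"
    by (simp add: sum.distrib sum_subtractf linear_functional_sum_Basis[OF lin] sum_Basis_I[OF lin]
        trace_form_def trace_I_def flip: sum_distrib_left)
  then show ?thesis using I_inner[of x w] inv by (simp add: inner_commute)
qed

text \<open>The right-hand side represents the real part of \<open>tr\<^sub>\<complex>(b) \<Psi>\<close>. The cyclic sum lies in
  \<^const>\<open>T_u3perp\<close> again, so it suffices to compare images under \<^const>\<open>r_map\<close>.\<close>

lemma cyclic_sum_tens:
  assumes b2: "b \<in> tensors2" and inv: "act_I I b = b"
  shows "tens b x y z + tens b y z x + tens b z x y
    = tens (scalar_form (trace_form b / 2) (- trace_I b / 2)) x y z"
proof -
  define S where "S = (\<lambda>x y z. tens b x y z + tens b y z x + tens b z x y)"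
  have b: "bilinear b" using b2 by (simp add: tensors2_def)
  note inv' = act_I_eqD[OF inv]
  note t = tens_trilinear[OF b2]
  have tri: "trilinear S"
    unfolding S_def
    using trilinear_add[OF trilinear_add[OF t trilinear_rotate[OF t]] trilinear_rotate[OF trilinear_rotate[OF t]]] .
  have "S x y z = - S x z y" for x y z
    unfolding S_def tens_def P_skew[of z y] P_skew[of x z] P_skew[of y x] bilinear_rneg[OF b] by simp
  moreover have "S x y z = - S x (I y) (I z)" for x y z
    unfolding S_def tens_def P_I_left P_I_right by (simp add: bilinear_rneg[OF b] inv')
  ultimately have S: "S \<in> T_u3perp I"
    unfolding T_u3perp_def using tri by blast
  have "r_map psi S x w = scalar_form (trace_form b / 2) (- trace_I b / 2) x w" for x w
  proof -
    have 1: "(\<Sum>e\<in>Basis. tens b x e (P w e)) = 4 * b x w"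
      using r_map_eq[OF tens_trilinear[OF b2], of x w] r_map_tens[OF b2] by simp
    \<comment> \<open>Moving the skew operator \<open>P w\<close> to the other argument shows that
      two of the three cyclic terms have the same contraction.\<close>
    have "(\<Sum>e\<in>Basis. b (P w e) (P x e)) = - (\<Sum>e\<in>Basis. b e (P x (P w e)))"
      using sum_Basis_skew_adjoint[OF bilinear_compose[OF b linear_id bilinear_linear(1)[OF bilinear_P]],
          where L = "P w", OF P_inner_right]
      by simp
    also have "\<dots> = (\<Sum>e\<in>Basis. b e (P (P w e) x))"
      unfolding sum_negf[symmetric] P_skew[of x] bilinear_rneg[OF b] by simp
    finally have 2: "(\<Sum>e\<in>Basis. tens b (P w e) x e) = (\<Sum>e\<in>Basis. tens b e (P w e) x)"
      by (simp add: tens_def)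
    have 3: "(\<Sum>e\<in>Basis. tens b e (P w e) x) = (x \<bullet> w) * trace_form b - (x \<bullet> I w) * trace_I b - 2 * b x w"
      unfolding tens_def by (rule sum_bilinear_P_P[OF b inv'])
    \<comment> \<open>The first term gives \<open>4 * b x w\<close> and the other two give
      \<open>- 2 * b x w\<close> each, so \<open>b\<close> itself cancels and only its traces
      remain.\<close>
    have "(\<Sum>e\<in>Basis. S x e (P w e))
      = (\<Sum>e\<in>Basis. tens b x e (P w e)) + (\<Sum>e\<in>Basis. tens b e (P w e) x) + (\<Sum>e\<in>Basis. tens b (P w e) x e)"
      unfolding S_def by (simp add: sum.distrib)
    then show ?thesis
      unfolding r_map_eq[OF tri] 2 3 1 scalar_form_def kaehler_form_def by (simp add: field_simps)
  qed
  then have "r_map psi S = scalar_form (trace_form b / 2) (- trace_I b / 2)"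
    by blast
  then have "tens (scalar_form (trace_form b / 2) (- trace_I b / 2)) = S"
    using tens_r_map[OF S] by simp
  then show ?thesis unfolding S_def by simp
qed

section \<open>The Gray-Hervella conditions on \<open>tens b\<close>\<close>

text \<open>Total skewness carries the type condition over to the first two arguments, which makes
  \<open>b\<close> invariant under \<open>I\<close>. The cyclic sum is then three times
  \<open>tens b\<close>, so \<open>cyclic_sum_tens\<close> and injectivity force \<open>b\<close> to
  be scalar.\<close>

lemma tens_in_W1_iff:
  assumes b2: "b \<in> tensors2"
  shows "tens b \<in> W1 I \<longleftrightarrow> (\<exists>c d. b = scalar_form c d)"
proof
  note T = tens_in_T_u3perp[OF b2]
  assume "tens b \<in> W1 I"
  then have sk: "tens b x y z = - tens b y x z" for x y z unfolding W1_def by blast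
  have cyc: "tens b x y z = tens b y z x" for x y z
    using sk[of y x z] T_u3perp_D(3)[OF T, of y z x] by linarith
  have "tens (act_I I b) x y z = tens b x y z" for x y z
    using tens_act_I[OF b2, of x y z] cyc[of z "I x" "I y"] T_u3perp_D(4)[OF T, of z x y] cyc[of z x y]
    by linarith
  then have inv: "act_I I b = b"
    using tens_inject[OF act_I_in_tensors2[OF b2] b2] by blast
  let ?c = "scalar_form (trace_form b / 2) (- trace_I b / 2)"
  have "tens b x y z = tens (scalar_form (trace_form b / 6) (- trace_I b / 6)) x y z" for x y z
  proof -
    have "3 * tens b x y z = tens ?c x y z"
      using cyclic_sum_tens[OF b2 inv, of x y z] cyc[of y z x] cyc[of x y z] by linarith
    then show ?thesis by (simp add: tens_def scalar_form_def field_simps)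
  qed
  then have "b = scalar_form (trace_form b / 6) (- trace_I b / 6)"
    using tens_inject[OF b2 scalar_form_in_tensors2] by blast
  then show "\<exists>c d. b = scalar_form c d" by blast
next
  assume "\<exists>c d. b = scalar_form c d"
  then obtain c d where b: "b = scalar_form c d" by blast
  have "tens b x y z = - tens b y x z" for x y z
  proof -
    \<comment> \<open>The tensors of the metric and of the Kaehler form are the real and imaginary
      parts of the complex volume form, both totally skew.\<close>
    have "x \<bullet> P y z = - (y \<bullet> P x z)" "x \<bullet> I (P y z) = - (y \<bullet> I (P x z))" for x y z
      using P_inner_left[of y z x] P_inner_left[of "I y" z x] P_I_left[of y z] P_I_left[of x z]
        I_inner[of "P y z" x] I_inner[of "P x z" y]  P_inner_left[of y z "I x"]
      by (simp_all add: inner_commute)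
    note 1 = this
    show ?thesis unfolding b tens_def scalar_form_def kaehler_form_def 1[of x y z] by simp
  qed
  then show "tens b \<in> W1 I" using tens_in_T_u3perp[OF b2] unfolding W1_def by blast
qed

text \<open>For invariant \<open>b\<close> the cyclic sum is the tensor of a scalar form built from
  the two traces, so it vanishes exactly when both do.\<close>

lemma tens_in_W2_iff:
  assumes b2: "b \<in> tensors2"
  shows "tens b \<in> W2 I \<longleftrightarrow> act_I I b = b \<and> trace_form b = 0 \<and> trace_I b = 0"
proof -
  note T = tens_in_T_u3perp[OF b2]
  have "tens b \<in> W2 I \<longleftrightarrow> trace_form b = 0 \<and> trace_I b = 0" if inv: "act_I I b = b"
  proof -
    have "tens b \<in> W2 I \<longleftrightarrow> (\<forall>x y z. tens (scalar_form (trace_form b / 2) (- trace_I b / 2)) x y z = 0)"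
      using T cyclic_sum_tens[OF b2 inv] by (simp add: W2_def)
    also have "\<dots> \<longleftrightarrow> tens (scalar_form (trace_form b / 2) (- trace_I b / 2)) = tens (\<lambda>x y. 0)"
      by (simp add: fun_eq_iff tens_def)
    also have "\<dots> \<longleftrightarrow> scalar_form (trace_form b / 2) (- trace_I b / 2) = (\<lambda>x y. 0)"
      using tens_inject[OF scalar_form_in_tensors2] scalar_form_in_tensors2[of 0 0]
        scalar_form_eq_0_iff[of 0 0] by metis
    finally show ?thesis by (simp add: scalar_form_eq_0_iff)
  qed
  moreover have "act_I I b = b" if "tens b \<in> W2 I"
  proof -
    have S: "tens b x y z + tens b y z x + tens b z x y = 0" for x y z
      using that unfolding W2_def by blast
    let ?c = "tens (act_I I b)"
    \<comment> \<open>This is the cyclic identity at \<open>I x\<close>, \<open>I y\<close>,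
      \<open>z\<close>. Adding its three rotations shows that the cyclic sum of \<open>?c\<close>
      vanishes too, whence \<open>?c\<close> agrees with \<open>tens b\<close>.\<close>
    have *: "?c x y z + ?c y z x + tens b z x y = 0" for x y z
      using S[of "I x" "I y" z] tens_act_I[OF b2, of x y z] tens_act_I[OF b2, of y z x]
        T_u3perp_D(4)[OF T, of z x y] tens_I_swap[of b "I y" z x]
      by linarith
    have "?c z x y = tens b z x y" for x y z
      using *[of x y z] *[of y z x] *[of z x y] S[of x y z] by linarith
    then show ?thesis using tens_inject[OF act_I_in_tensors2[OF b2] b2] by blast
  qed
  ultimately show ?thesis by blast
qed

text \<open>The first condition says that \<open>b\<close> is anti-invariant. Given this, the skew
  part of \<open>b\<close> is represented by a vector, and the trace condition says that this vector
  is zero.\<close>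

lemma tens_in_W3_iff:
  assumes b2: "b \<in> tensors2"
  shows "tens b \<in> W3 I \<longleftrightarrow> symmetric_form b \<and> act_I I b = (\<lambda>x y. - b x y)"
proof -
  note T = tens_in_T_u3perp[OF b2]
  have b: "bilinear b" using b2 by (simp add: tensors2_def)
  have neg: "(\<lambda>x y. - b x y) \<in> tensors2" using bilinear_scale[OF b, of "-1"] by (simp add: tensors2_def)
  have 1: "(\<forall>x y z. tens b (I x) (I y) z = tens b x y z) \<longleftrightarrow> act_I I b = (\<lambda>x y. - b x y)"
  proof -
    have "(\<forall>x y z. tens b (I x) (I y) z = tens b x y z) \<longleftrightarrow> tens (act_I I b) = tens (\<lambda>x y. - b x y)"
      unfolding fun_eq_iff tens_act_I[OF b2] by (simp add: tens_def)
    then show ?thesis using tens_inject[OF act_I_in_tensors2[OF b2] neg] by metis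
  qed
  have skew: "P x z \<bullet> y = - (P y z \<bullet> x)" for x y z by (rule P_inner_left)
  have 2: "(\<forall>z. (\<Sum>e\<in>Basis. tens b e e z) = 0) \<longleftrightarrow> symmetric_form b" if "act_I I b = (\<lambda>x y. - b x y)"
  proof
    assume "symmetric_form b"
    then have sym: "b x y = b y x" for x y unfolding symmetric_form_def by blast
    have "(\<Sum>e\<in>Basis. b e (P e z)) = 0" for z
      using sum_Basis_skew_adjoint[OF b skew, of z] sym[of _ "P _ z"] by simp
    then show "\<forall>z. (\<Sum>e\<in>Basis. tens b e e z) = 0" by (simp add: tens_def)
  next
    assume tr: "\<forall>z. (\<Sum>e\<in>Basis. tens b e e z) = 0"
    note anti = act_I_uminusD[OF that]
    have k: "bilinear (\<lambda>x y. b x y - b y x)"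
      using b unfolding bilinear_def by (auto intro: linear_compose_sub)
    obtain v where v: "\<And>x y. b x y - b y x = P v x \<bullet> y"
      by (rule skew_type_representation[OF k]) (simp_all add: anti)
    have "v \<bullet> z = 0" for z
    proof -
      have lin: "linear (\<lambda>e::'a. e \<bullet> z)" for z by (rule bilinear_linear(2)[OF bilinear_inner])
      \<comment> \<open>The operator \<open>\<lambda>e. P e z\<close> is skew, so the contraction
        sees only the skew part of \<open>b\<close>; the factor 2 accounts for the
        antisymmetrisation. The value is v - 6v + v, paired with \<open>z\<close>.\<close>
      have "0 = 2 * (\<Sum>e\<in>Basis. b e (P e z))" using tr by (simp add: tens_def)
      also have "\<dots> = (\<Sum>e\<in>Basis. b e (P e z) - b (P e z) e)"
        using sum_Basis_skew_adjoint[OF b skew, of z] by (simp add: sum_subtractf)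
      also have "\<dots> = (\<Sum>e\<in>Basis. (v \<bullet> e) * (e \<bullet> z) - v \<bullet> z - (v \<bullet> I e) * (e \<bullet> I z))"
        unfolding v P_inner_P by (intro sum.cong refl) simp
      also have "\<dots> = - 4 * (v \<bullet> z)"
        unfolding sum_subtractf linear_functional_sum_Basis[OF lin] sum_Basis_I[OF lin]
        by (simp add: dim)
      finally show ?thesis by simp
    qed
    then have "v = 0" using inner_eq_zero_iff by blast
    then show "symmetric_form b"
      using v bilinear_lzero[OF bilinear_P] by (simp add: symmetric_form_def)
  qed
  show ?thesis unfolding W3_def using T 1 2 by blast
qed

text \<open>By \<open>P_inner_P\<close>, the tensor of the form \<open>P v x \<bullet> y\<close> is
  the defining expression with \<tau> the negative of the inner product with \<open>v\<close>. By
  \<open>skew_type_representation\<close> such forms exhaust the skew anti-invariant ones.\<close>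

lemma tens_in_W4_iff:
  assumes b2: "b \<in> tensors2"
  shows "tens b \<in> W4 I \<longleftrightarrow> skew_form b \<and> act_I I b = (\<lambda>x y. - b x y)"
proof -
  note T = tens_in_T_u3perp[OF b2]
  have b: "bilinear b" using b2 by (simp add: tensors2_def)
  have formula: "tens (\<lambda>x y. P v x \<bullet> y) x y z
      = (x \<bullet> y) * - (v \<bullet> z) - (x \<bullet> z) * - (v \<bullet> y) - (x \<bullet> I y) * - (v \<bullet> I z) + (x \<bullet> I z) * - (v \<bullet> I y)"
    for v x y z
    unfolding tens_def P_inner_P by (simp add: algebra_simps)
  show ?thesis
  proof
    assume "tens b \<in> W4 I"
    then obtain \<tau> where lin: "linear \<tau>" and \<tau>: "\<And>x y z. tens b x y z = (x \<bullet> y) * \<tau> z - (x \<bullet> z) * \<tau> y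
                        - (x \<bullet> I y) * \<tau> (I z) + (x \<bullet> I z) * \<tau> (I y)"
      unfolding W4_def by blast
    obtain u where "\<And>x. \<tau> x = u \<bullet> x" using linear_functional_representation[OF lin] by blast
    then have u: "\<tau> x = - (- u \<bullet> x)" for x by simp
    have "tens b = tens (\<lambda>x y. P (- u) x \<bullet> y)"
      by (intro ext) (simp only: \<tau> formula u)
    moreover have "(\<lambda>x y. P (- u) x \<bullet> y) \<in> tensors2"
      using bilinear_compose[OF bilinear_inner bilinear_linear(1)[OF bilinear_P] linear_id]
      by (simp add: tensors2_def)
    ultimately have b_eq: "b = (\<lambda>x y. P (- u) x \<bullet> y)" using tens_inject[OF b2] by blast
    have "b x y = - b y x" for x y unfolding b_eq by (rule P_inner_right)
    moreover have "b (I x) (I y) = - b x y" for x y unfolding b_eq P_I_right by simp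
    ultimately show "skew_form b \<and> act_I I b = (\<lambda>x y. - b x y)"
      unfolding skew_form_def act_I_def by blast
  next
    assume *: "skew_form b \<and> act_I I b = (\<lambda>x y. - b x y)"
    then have "b x y = - b y x" "b (I x) (I y) = - b x y" for x y
      unfolding skew_form_def by (blast, metis act_I_uminusD)
    then obtain v where "\<And>x y. b x y = P v x \<bullet> y"
      using skew_type_representation[OF b] by blast
    then have b_eq: "b = (\<lambda>x y. P v x \<bullet> y)" by blast
    have "linear (\<lambda>x. - (v \<bullet> x))"
      by (intro linear_compose_neg bilinear_linear(1)[OF bilinear_inner])
    then show "tens b \<in> W4 I"
      using T formula[of v] unfolding W4_def b_eq by blast
  qed
qed

section \<open>Equivariance under SU(3)\<close>

text \<open>The metric and \<open>psi\<close> determine \<open>P\<close>, so an isometry preserving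
  \<open>psi\<close> commutes with \<open>P\<close>.\<close>

lemma act3_tens:
  assumes A: "orthogonal_transformation A" and psi_A: "\<And>x y z. psi (A x) (A y) (A z) = psi x y z"
  shows "act3 A (tens b) = tens (act2 A b)"
proof -
  have P_A: "P (A x) (A y) = A (P x y)" for x y
  proof (rule vector_eq_rdot[THEN iffD1], rule allI)
    fix z
    obtain w where z: "z = A w" using orthogonal_transformation_surj[OF A] by (metis surjD)
    show "P (A x) (A y) \<bullet> z = A (P x y) \<bullet> z"
      using psi_A[of x y w] A by (simp add: z psi_def orthogonal_transformation_def)
  qed
  have "bij A" by (rule orthogonal_transformation_bij[OF A])
  then have "P (inv A y) (inv A z) = inv A (P y z)" for y z
    using P_A[of "inv A y" "inv A z"] by (metis bij_inv_eq_iff)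
  then show ?thesis by (simp add: act3_def act2_def tens_def fun_eq_iff)
qed

lemma act2_in_tensors2:
  assumes A: "orthogonal_transformation A" and "b \<in> tensors2"
  shows "act2 A b \<in> tensors2"
  using assms orthogonal_transformation_linear[OF orthogonal_transformation_inv[OF A]]
  by (simp add: tensors2_def act2_def bilinear_compose)

text \<open>Equivariance is proved for \<open>tens\<close> and passes to its inverse. The locale
  knows \<open>psi\<close> but not \<open>\<Psi>\<close>, so invariance of \<open>psi\<close> is
  assumed here and supplied in the final proof.\<close>

lemma SU3_isomorphism_r_map:
  assumes "\<And>A x y z. A \<in> SU3 I \<Psi> \<Longrightarrow> psi (A x) (A y) (A z) = psi x y z"
  shows "SU3_isomorphism I \<Psi> (T_u3perp I) tensors2 (r_map psi)"
  unfolding SU3_isomorphism_def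
proof (intro conjI ballI allI)
  show "bij_betw (r_map psi) (T_u3perp I) tensors2" by (rule bij_betw_r_map)
  fix A \<alpha> assume A: "A \<in> SU3 I \<Psi>" and \<alpha>: "\<alpha> \<in> T_u3perp I"
  let ?b = "r_map psi \<alpha>"
  have orth: "orthogonal_transformation A" using A by (simp add: SU3_def)
  have b: "?b \<in> tensors2" using \<alpha> r_map_in_tensors2 T_u3perp_D(1) by blast
  have act: "act3 A \<alpha> = tens (act2 A ?b)"
    using act3_tens[OF orth assms[OF A], of ?b] tens_r_map[OF \<alpha>] by simp
  have b': "act2 A ?b \<in> tensors2" by (rule act2_in_tensors2[OF orth b])
  show "act3 A \<alpha> \<in> T_u3perp I" "r_map psi (act3 A \<alpha>) = act2 A ?b"
    unfolding act by (rule tens_in_T_u3perp[OF b'], rule r_map_tens[OF b'])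
qed (simp_all add: r_map_def inner_2form_def fun_eq_iff sum.distrib sum_distrib_left algebra_simps)

section \<open>Images of the components\<close>

lemma image_r_map_subset:
  assumes "W \<subseteq> T_u3perp I"
  shows "r_map psi ` {\<alpha> \<in> W. Q (r_map psi \<alpha>)} = {b \<in> tensors2. tens b \<in> W \<and> Q b}"
proof -
  have "{\<alpha> \<in> W. Q (r_map psi \<alpha>)} = {\<alpha> \<in> T_u3perp I. \<alpha> \<in> W \<and> Q (r_map psi \<alpha>)}"
    using assms by blast
  then have "r_map psi ` {\<alpha> \<in> W. Q (r_map psi \<alpha>)}
      = {b \<in> tensors2. tens b \<in> W \<and> Q (r_map psi (tens b))}"
    by (simp only: image_r_map)
  then show ?thesis by (simp add: r_map_tens cong: conj_cong)
qed

lemma W_subset: "W1 I \<subseteq> T_u3perp I" "W2 I \<subseteq> T_u3perp I" "W3 I \<subseteq> T_u3perp I" "W4 I \<subseteq> T_u3perp I"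
  unfolding W1_def W2_def W3_def W4_def by (rule Collect_restrict)+

text \<open>The metric is symmetric and the Kaehler form is skew. Symmetry of a scalar form
  therefore removes \<open>d\<close> and skewness removes \<open>c\<close>, which separates the two
  halves of \<open>W1 I\<close>.\<close>

lemma scalar_form_transpose: "scalar_form c d y x = scalar_form c (- d) x y"
  unfolding scalar_form_def kaehler_form_def inner_commute[of y x] inner_commute[of y "I x"] I_inner
  by simp

lemma image_r_map_W1_plus:
  "r_map psi ` W1_plus I psi = {b. \<exists>c. b = (\<lambda>x y. c * (x \<bullet> y))}"
proof -
  have eq: "(\<lambda>x y. c * (x \<bullet> y)) = scalar_form c 0" for c
    by (simp add: scalar_form_def fun_eq_iff)
  have sym: "scalar_form c d = scalar_form c 0" if "symmetric_form (scalar_form c d)" for c d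
  proof (intro ext)
    fix x y
    have "scalar_form c d x y = scalar_form c (- d) x y"
      using that scalar_form_transpose[of c d y x] unfolding symmetric_form_def by metis
    then show "scalar_form c d x y = scalar_form c 0 x y" by (simp add: scalar_form_def)
  qed
  have "symmetric_form (scalar_form c 0)" for c
    by (simp add: symmetric_form_def scalar_form_def inner_commute)
  then have "{b \<in> tensors2. tens b \<in> W1 I \<and> symmetric_form b} = {b. \<exists>c. b = scalar_form c 0}"
    using scalar_form_in_tensors2 tens_in_W1_iff sym by fastforce
  then show ?thesis
    unfolding W1_plus_def image_r_map_subset[OF W_subset(1)] eq .
qed

lemma image_r_map_W1_minus:
  "r_map psi ` W1_minus I psi = {b. \<exists>c. b = (\<lambda>x y. c * kaehler_form I x y)}"
proof -
  have eq: "(\<lambda>x y. d * kaehler_form I x y) = scalar_form 0 d" for d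
    by (simp add: scalar_form_def fun_eq_iff)
  have skew: "scalar_form c d = scalar_form 0 d" if "skew_form (scalar_form c d)" for c d
  proof (intro ext)
    fix x y
    have "scalar_form c d x y = - scalar_form c (- d) x y"
      using that scalar_form_transpose[of c d y x] unfolding skew_form_def by metis
    then show "scalar_form c d x y = scalar_form 0 d x y" by (simp add: scalar_form_def)
  qed
  have "skew_form (scalar_form 0 d)" for d
    unfolding skew_form_def
  proof (intro allI)
    fix x y
    have "scalar_form 0 d x y = scalar_form 0 (- d) y x" by (rule scalar_form_transpose)
    then show "scalar_form 0 d x y = - scalar_form 0 d y x" by (simp add: scalar_form_def)
  qed
  then have "{b \<in> tensors2. tens b \<in> W1 I \<and> skew_form b} = {b. \<exists>d. b = scalar_form 0 d}"
    using scalar_form_in_tensors2 tens_in_W1_iff skew by fastforce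
  then show ?thesis
    unfolding W1_minus_def image_r_map_subset[OF W_subset(1)] eq .
qed

text \<open>Invariance gives \<open>b e (I e) = - b (I e) e\<close>, so symmetry makes each summand
  zero. Only the ordinary trace remains as a condition for \<open>W2_plus\<close>.\<close>

lemma trace_I_symmetric:
  assumes "bilinear b" "symmetric_form b" "act_I I b = b"
  shows "trace_I b = 0"
proof -
  have "b e (I e) = 0" for e
  proof -
    have "b e (I e) = b (I e) (I (I e))" using act_I_eqD[OF assms(3), of e "I e"] by simp
    also have "\<dots> = - b (I e) e" using bilinear_rneg[OF assms(1)] by simp
    also have "b (I e) e = b e (I e)" using assms(2) unfolding symmetric_form_def by blast
    finally show ?thesis by simp
  qed
  then show ?thesis by (simp add: trace_I_def)
qed

lemma trace_form_skew: "skew_form b \<Longrightarrow> trace_form b = 0"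
  unfolding trace_form_def skew_form_def by (intro sum.neutral ballI) (metis equal_neg_zero)

text \<open>For skew \<open>b\<close> this turns the vanishing of \<open>trace_I\<close> into
  orthogonality to the Kaehler form.\<close>

lemma inner_2form_kaehler_form:
  assumes "bilinear b" "skew_form b"
  shows "inner_2form (kaehler_form I) b = - trace_I b / 2"
proof -
  have lin: "linear (b e)" for e by (rule bilinear_linear(1)[OF assms(1)])
  have "(\<Sum>f\<in>Basis. (e \<bullet> I f) * b e f) = - b e (I e)" for e
    by (rule sum_Basis_I[OF lin])
  then show ?thesis
    by (simp add: inner_2form_def kaehler_form_def trace_I_def sum_negf)
qed

lemma image_r_map_W2_plus:
  "r_map psi ` W2_plus I psi
    = {b \<in> tensors2. trace_form b = 0 \<and> symmetric_form b \<and> act_I I b = b}"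
proof -
  have "tens b \<in> W2 I \<and> symmetric_form b
      \<longleftrightarrow> trace_form b = 0 \<and> symmetric_form b \<and> act_I I b = b" if b: "b \<in> tensors2" for b
  proof -
    have "bilinear b" using b by (simp add: tensors2_def)
    then show ?thesis using tens_in_W2_iff[OF b] trace_I_symmetric by blast
  qed
  then show ?thesis unfolding W2_plus_def image_r_map_subset[OF W_subset(2)] by blast
qed

lemma image_r_map_W2_minus:
  "r_map psi ` W2_minus I psi
    = {b \<in> tensors2. skew_form b \<and> act_I I b = b \<and> inner_2form (kaehler_form I) b = 0}"
proof -
  have "tens b \<in> W2 I \<and> skew_form b
      \<longleftrightarrow> skew_form b \<and> act_I I b = b \<and> inner_2form (kaehler_form I) b = 0"
    if b: "b \<in> tensors2" for b
  proof -
    have "inner_2form (kaehler_form I) b = 0 \<longleftrightarrow> trace_I b = 0" if "skew_form b"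
      using b that by (simp add: inner_2form_kaehler_form tensors2_def)
    then show ?thesis using tens_in_W2_iff[OF b] trace_form_skew by blast
  qed
  then show ?thesis unfolding W2_minus_def image_r_map_subset[OF W_subset(2)] by blast
qed

lemma image_r_map_W3:
  "r_map psi ` W3 I = {b \<in> tensors2. symmetric_form b \<and> act_I I b = (\<lambda>x y. - b x y)}"
  using image_r_map_subset[OF W_subset(3), of "\<lambda>_. True"] tens_in_W3_iff by simp blast

lemma image_r_map_W4:
  "r_map psi ` W4 I = {b \<in> tensors2. skew_form b \<and> act_I I b = (\<lambda>x y. - b x y)}"
  using image_r_map_subset[OF W_subset(4), of "\<lambda>_. True"] tens_in_W4_iff by simp blast

end

theorem proposition2p6:
  fixes I :: "'a::euclidean_space \<Rightarrow> 'a"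
    and \<psi>p \<psi>m :: "'a \<Rightarrow> 'a \<Rightarrow> 'a \<Rightarrow> real"
    and \<Psi> :: "'a \<Rightarrow> 'a \<Rightarrow> 'a \<Rightarrow> complex"
  assumes "DIM('a) = 6"
    and "\<Psi> = (\<lambda>x y z. of_real (\<psi>p x y z) + \<i> * of_real (\<psi>m x y z))"
    and "su3_structure I \<Psi>"
  shows "SU3_isomorphism I \<Psi> (T_u3perp I) tensors2 (r_map \<psi>p)
    \<and> r_map \<psi>p ` W1_plus I \<psi>p = {b. \<exists>c. b = (\<lambda>x y. c * (x \<bullet> y))}
    \<and> r_map \<psi>p ` W1_minus I \<psi>p = {b. \<exists>c. b = (\<lambda>x y. c * kaehler_form I x y)}
    \<and> r_map \<psi>p ` W2_plus I \<psi>p =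
        {b \<in> tensors2. trace_form b = 0 \<and> symmetric_form b \<and> act_I I b = b}
    \<and> r_map \<psi>p ` W2_minus I \<psi>p =
        {b \<in> tensors2. skew_form b \<and> act_I I b = b \<and> inner_2form (kaehler_form I) b = 0}
    \<and> r_map \<psi>p ` W3 I = {b \<in> tensors2. symmetric_form b \<and> act_I I b = (\<lambda>x y. - b x y)}
    \<and> r_map \<psi>p ` W4 I = {b \<in> tensors2. skew_form b \<and> act_I I b = (\<lambda>x y. - b x y)}"
proof -
  obtain P where P: "su3_cross I P" and psip: "\<And>x y z. \<psi>p x y z = P x y \<bullet> z"
    using su3_structure_imp_su3_cross[OF assms] by blast
  interpret su3_cross I P by (rule P)
  have psi: "\<psi>p = psi" by (intro ext) (simp add: psip psi_def)
  have "psi (A x) (A y) (A z) = psi x y z" if "A \<in> SU3 I \<Psi>" for A x y z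
  proof -
    have "\<Psi> (A x) (A y) (A z) = \<Psi> x y z" using that unfolding SU3_def by blast
    \<comment> \<open>The real part of \<open>\<Psi>\<close> is \<open>\<psi>p\<close>, so
      preserving \<open>\<Psi>\<close> preserves \<open>psi\<close>.\<close>
    then have "Re (\<Psi> (A x) (A y) (A z)) = Re (\<Psi> x y z)" by (rule arg_cong)
    then show ?thesis using assms(2) psi by simp
  qed
  then show ?thesis
    unfolding psi
    using SU3_isomorphism_r_map image_r_map_W1_plus image_r_map_W1_minus image_r_map_W2_plus
      image_r_map_W2_minus image_r_map_W3 image_r_map_W4
    by blast
qed

end
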